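(* Let $A$ be a unital complex Banach algebra and let $a\in A$. Then the following statements are equivalent: (i) $\sigma_{\mathcal{DR}}(a)=\emptyset$; (ii) $\partial\sigma(a)\subseteq \rho_{\mathcal{DR}}(a)$; (iii) $a$ is algebraic.
   Context: Let $A$ be a unital complex Banach algebra with unit $e$; for $\lambda\in\mathbb C$, $a-\lambda$ means $a-\lambda e$. An element $a\in A$ is Drazin invertible if there exist $b\in A$ and $m\in\mathbb N$ such that $a^mba=a^m$, $bab=b$ and $ab=ba$. Let $\mathcal{DR}(A)$ be the set of Drazin invertible elements of $A$. The Drazin spectrum of $a$ is $\sigma_{\mathcal{DR}}(a)=\{\lambda\in\mathbb C: a-\lambda\notin\mathcal{DR}(A)\}$, and the Drazin resolvent set is $\rho_{\mathcal{DR}}(a)=\mathbb C\setminus\sigma_{\mathcal{DR}}(a)$. $\sigma(a)$ is the usual spectrum of $a$ and $\partial\sigma(a)$ its topological boundary in $\mathbb C$. The element $a$ is algebraic if there exists a nonzero polynomial $P$ with complex coefficients such that $P(a)=0$. *)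

theory Defs
  imports "HOL-Analysis.Analysis" "HOL-Computational_Algebra.Polynomial"
begin

(* Neither norm 1 = 1 nor 1 \<noteq> 0 is assumed, so equivalent renormings and the zero algebra
   are included; this is why the class does not extend real_normed_algebra_1.
   Submultiplicativity of the norm comes from real_normed_algebra, completeness from banach;
   the law 1 *\<^sub>C x = x follows from scaleR_scaleC. *)
class complex_banach_algebra = real_normed_algebra + monoid_mult + banach +
  fixes scaleC :: "complex \<Rightarrow> 'a \<Rightarrow> 'a"  (infixr "*\<^sub>C" 75)
  assumes scaleC_add_right: "c *\<^sub>C (x + y) = c *\<^sub>C x + c *\<^sub>C y"
    and scaleC_add_left: "(c + d) *\<^sub>C x = c *\<^sub>C x + d *\<^sub>C x"
    and scaleC_scaleC: "c *\<^sub>C (d *\<^sub>C x) = (c * d) *\<^sub>C x"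
    and scaleR_scaleC: "r *\<^sub>R x = complex_of_real r *\<^sub>C x"
    and mult_scaleC_left: "(c *\<^sub>C x) * y = c *\<^sub>C (x * y)"
    and mult_scaleC_right: "x * (c *\<^sub>C y) = c *\<^sub>C (x * y)"
    and norm_scaleC: "norm (c *\<^sub>C x) = cmod c * norm x"

definition invertible_elem :: "'a::complex_banach_algebra \<Rightarrow> bool" where
  "invertible_elem a \<longleftrightarrow> (\<exists>b. a * b = 1 \<and> b * a = 1)"

definition spectrum :: "'a::complex_banach_algebra \<Rightarrow> complex set" where
  "spectrum a = {z. \<not> invertible_elem (a - z *\<^sub>C 1)}"

(* Allowing m = 0 is harmless: it forces b * a = 1, and then m = 1 works as well. *)
definition drazin_invertible :: "'a::complex_banach_algebra \<Rightarrow> bool" where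
  "drazin_invertible a \<longleftrightarrow>
     (\<exists>b. \<exists>m::nat. a ^ m * b * a = a ^ m \<and> b * a * b = b \<and> a * b = b * a)"

definition drazin_spectrum :: "'a::complex_banach_algebra \<Rightarrow> complex set" where
  "drazin_spectrum a = {z. \<not> drazin_invertible (a - z *\<^sub>C 1)}"

definition drazin_resolvent_set :: "'a::complex_banach_algebra \<Rightarrow> complex set" where
  "drazin_resolvent_set a = UNIV - drazin_spectrum a"

definition poly_eval :: "complex poly \<Rightarrow> 'a::complex_banach_algebra \<Rightarrow> 'a" where
  "poly_eval p a = (\<Sum>k\<le>degree p. coeff p k *\<^sub>C a ^ k)"

(* Named apart from the library constant algebraic, which concerns roots of integer
   polynomials in a field of characteristic zero. *)
definition algebraic_elem :: "'a::complex_banach_algebra \<Rightarrow> bool" where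
  "algebraic_elem a \<longleftrightarrow> (\<exists>p. p \<noteq> 0 \<and> poly_eval p a = 0)"

end

theory Submission
  imports Defs
begin

text \<open>If \<open>P (a) = 0\<close>, fix a complex number \<open>z\<close> and put \<open>c = a - z\<close>. Removing from \<open>P\<close> its
  zero at \<open>z\<close>, of order \<open>m\<close> say, shows \<open>c\<^sup>m = c\<^sup>m\<^sup>+\<^sup>1 t\<close> for some \<open>t\<close> commuting with \<open>c\<close>, and
  this makes \<open>c\<^sup>m t\<^sup>m\<^sup>+\<^sup>1\<close> a Drazin inverse of \<open>c\<close>
  (\<open>algebraic_imp_drazin_invertible\<close>). So an algebraic element has empty Drazin spectrum, and
  the frontier of its spectrum is then trivially contained in the Drazin resolvent set.

  The converse is the analytic half. A Drazin inverse \<open>b\<close> of \<open>a - z\<close> yields an idempotent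
  \<open>p = (a - z) b\<close> that splits the algebra: on the corner of \<open>p\<close> the element \<open>a - z\<close> is invertible,
  on the corner of \<open>1 - p\<close> it is nilpotent. Hence \<open>a - z - w\<close> is invertible for all small
  \<open>w \<noteq> 0\<close>, that is, points of the Drazin resolvent set are isolated in the spectrum. If all
  frontier points are of this kind, then the frontier is finite, and since a finite set does not
  separate the plane, the bounded spectrum coincides with its frontier
  (\<open>finite_spectrum_if_frontier_drazin\<close>).

  Now let \<open>f\<close> be the product of the idempotents \<open>p\<close> over the finitely many points of the
  spectrum, and \<open>P\<close> the product of the corresponding powers \<open>(X - z)\<^sup>m\<close>, so that
  \<open>P (a) f = P (a)\<close> (\<open>split_off_finite\<close>). In the corner of \<open>f\<close> the element \<open>a - z\<close> is invertible for
  every complex \<open>z\<close>, and the spectrum of an element of a nonzero Banach algebra is not empty.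
  Therefore \<open>f = 0\<close> (\<open>entire_resolvent_trivial\<close>) and \<open>P (a) = 0\<close>.\<close>

section \<open>Complex scalars\<close>

lemma scaleC_one [simp]: "1 *\<^sub>C x = (x :: 'a::complex_banach_algebra)"
  using scaleR_scaleC[of 1 x] by simp

lemma bounded_bilinear_scaleC:
  "bounded_bilinear (scaleC :: complex \<Rightarrow> 'a \<Rightarrow> 'a::complex_banach_algebra)"
proof
  show "(r *\<^sub>R c) *\<^sub>C x = r *\<^sub>R (c *\<^sub>C x)" for r c and x :: 'a
    by (simp add: scaleR_scaleC scaleC_scaleC scaleR_conv_of_real)
  show "c *\<^sub>C (r *\<^sub>R x) = r *\<^sub>R (c *\<^sub>C x)" for r c and x :: 'a
    by (simp add: scaleR_scaleC scaleC_scaleC mult.commute)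
  show "\<exists>K. \<forall>c (x :: 'a). norm (c *\<^sub>C x) \<le> norm c * norm x * K"
    by (rule exI[of _ 1]) (simp add: norm_scaleC)
qed (simp_all add: scaleC_add_left scaleC_add_right)

interpretation scaleC: bounded_bilinear
  "scaleC :: complex \<Rightarrow> 'a \<Rightarrow> 'a::complex_banach_algebra"
  by (rule bounded_bilinear_scaleC)

lemma diff_scaleC_one_commute:
  fixes a x :: "'a::complex_banach_algebra"
  shows "x * (a - z *\<^sub>C 1) = (a - z *\<^sub>C 1) * x \<longleftrightarrow> x * a = a * x"
  by (auto simp: right_diff_distrib left_diff_distrib mult_scaleC_left mult_scaleC_right)

lemma diff_diff_scaleC_one:
  fixes a :: "'a::complex_banach_algebra"
  shows "a - z *\<^sub>C 1 - w *\<^sub>C 1 = a - (z + w) *\<^sub>C 1"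
  by (simp add: scaleC_add_left)

section \<open>Evaluating polynomials\<close>

lemma poly_eval_bound:
  fixes a :: "'a::complex_banach_algebra"
  assumes "degree p \<le> n"
  shows "poly_eval p a = (\<Sum>k\<le>n. coeff p k *\<^sub>C a ^ k)"
  unfolding poly_eval_def using assms
  by (intro sum.mono_neutral_left) (auto simp: coeff_eq_0 scaleC.zero_left)

lemma poly_eval_0 [simp]: "poly_eval 0 a = 0"
  by (simp add: poly_eval_def scaleC.zero_left)

lemma poly_eval_pCons:
  "poly_eval (pCons c p) a = c *\<^sub>C 1 + a * poly_eval p a"
proof -
  have "poly_eval (pCons c p) a = (\<Sum>k\<le>Suc (degree p). coeff (pCons c p) k *\<^sub>C a ^ k)"
    by (rule poly_eval_bound) (simp add: degree_pCons_le)
  also have "\<dots> = c *\<^sub>C 1 + a * poly_eval p a"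
    by (simp add: sum.atMost_Suc_shift poly_eval_def sum_distrib_left mult_scaleC_right
        del: sum.atMost_Suc)
  finally show ?thesis .
qed

lemma poly_eval_add: "poly_eval (p + q) a = poly_eval p a + poly_eval q a"
proof -
  let ?n = "max (degree p) (degree q)"
  have "poly_eval (p + q) a = (\<Sum>k\<le>?n. coeff (p + q) k *\<^sub>C a ^ k)"
    "poly_eval p a = (\<Sum>k\<le>?n. coeff p k *\<^sub>C a ^ k)"
    "poly_eval q a = (\<Sum>k\<le>?n. coeff q k *\<^sub>C a ^ k)"
    by (intro poly_eval_bound; simp add: degree_add_le_max)+
  then show ?thesis
    by (simp add: scaleC_add_left sum.distrib)
qed

lemma poly_eval_smult: "poly_eval (smult c p) a = c *\<^sub>C poly_eval p a"
  unfolding poly_eval_bound[OF degree_smult_le] poly_eval_def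
  by (simp add: scaleC.sum_right scaleC_scaleC scaleC.zero_left)

lemma poly_eval_mult: "poly_eval (p * q) a = poly_eval p a * poly_eval q a"
  by (induction p)
     (simp_all add: poly_eval_add poly_eval_smult poly_eval_pCons scaleC.zero_left
       distrib_right mult_scaleC_left mult.assoc)

lemma poly_eval_one [simp]: "poly_eval 1 a = 1"
  by (simp add: one_pCons poly_eval_pCons)

lemma poly_eval_power: "poly_eval (p ^ n) a = poly_eval p a ^ n"
  by (induction n) (simp_all add: poly_eval_mult)

lemma poly_eval_linear: "poly_eval [:- z, 1:] a = a - z *\<^sub>C 1"
  by (simp add: poly_eval_pCons scaleC.minus_left)

lemma poly_eval_commute: "poly_eval p a * a = a * poly_eval p a"
  by (induction p)
     (simp_all add: poly_eval_pCons distrib_left distrib_right mult_scaleC_left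
       mult_scaleC_right mult.assoc)

section \<open>Drazin inverses\<close>

lemma commuting_power_product:
  fixes x y :: "'a::monoid_mult"
  assumes "x * y = y * x"
  shows "(x ^ i * y ^ j) * (x ^ k * y ^ l) = x ^ (i + k) * y ^ (j + l)"
proof -
  have "y ^ j * x ^ k = x ^ k * y ^ j"
    by (rule power_commuting_commutes, rule power_commuting_commutes[symmetric], rule assms)
  then have "(x ^ i * y ^ j) * (x ^ k * y ^ l) = x ^ i * (x ^ k * y ^ j) * y ^ l"
    by (metis mult.assoc)
  then show ?thesis
    by (simp only: power_add mult.assoc)
qed

lemma power_stable_absorb:
  fixes c t :: "'a::monoid_mult"
  assumes "c * t = t * c" "c ^ m = c ^ Suc m * t"
  shows "c ^ (m + k) * t ^ k = c ^ m"
proof (induction k)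
  case (Suc k)
  have "c ^ (m + Suc k) = c ^ k * c ^ Suc m"
    by (simp only: power_add[symmetric]) (simp only: ac_simps add_Suc_right)
  then have "c ^ (m + Suc k) * t ^ Suc k = c ^ k * (c ^ Suc m * t) * t ^ k"
    by (simp only: power_Suc[of t] mult.assoc)
  also have "\<dots> = c ^ (m + k) * t ^ k"
    by (simp only: assms(2)[symmetric] power_add[symmetric] add.commute)
  finally show ?case
    using Suc.IH by simp
qed simp

text \<open>The element \<open>b = c\<^sup>m t\<^sup>m\<^sup>+\<^sup>1\<close> works: every identity required of it compares monomials
  in the commuting elements \<open>c\<close> and \<open>t\<close>, and a surplus factor \<open>c t\<close> may be cancelled as soon as
  \<open>c\<^sup>m\<close> is present.\<close>

lemma drazin_invertible_if_power_stable:
  fixes c t :: "'a::complex_banach_algebra"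
  assumes ct: "c * t = t * c" and st: "c ^ m = c ^ Suc m * t"
  shows "drazin_invertible c"
proof -
  let ?b = "c ^ m * t ^ Suc m"
  note absorb = power_stable_absorb[OF ct st]
  have bc: "?b * c = c ^ Suc m * t ^ Suc m" and cb: "c * ?b = c ^ Suc m * t ^ Suc m"
    using commuting_power_product[OF ct, of m "Suc m" 1 0]
      commuting_power_product[OF ct, of 1 0 m "Suc m"] by simp_all
  have "c ^ m * ?b * c = c ^ (m + Suc m) * t ^ Suc m"
    using bc commuting_power_product[OF ct, of m 0 "Suc m" "Suc m"] by (simp add: mult.assoc)
  then have 1: "c ^ m * ?b * c = c ^ m"
    by (simp only: absorb)
  have "?b * c * ?b = c ^ (m + Suc m) * t ^ (Suc m + Suc m)"
    using bc commuting_power_product[OF ct, of "Suc m" "Suc m" m "Suc m"]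
    by (simp only: add.commute)
  also have "\<dots> = ?b"
    by (simp only: power_add[of t] mult.assoc[symmetric] absorb)
  finally show ?thesis
    unfolding drazin_invertible_def using 1 bc cb by metis
qed

text \<open>For a Drazin inverse \<open>b\<close> of \<open>c\<close>, the product \<open>p = c b\<close> is an idempotent, the complement of
  the spectral projection at \<open>0\<close>: \<open>c\<close> is invertible with inverse \<open>b\<close> in the corner cut out by
  \<open>p\<close>, and \<open>c\<^sup>m\<close> vanishes on the complementary corner.\<close>

locale drazin_inverse =
  fixes c b :: "'a::complex_banach_algebra" and m :: nat
  assumes absorb: "c ^ m * b * c = c ^ m" and bcb: "b * c * b = b" and commute: "c * b = b * c"
begin

definition p :: 'a where "p = c * b"

lemma p_idem: "p * p = p"
  by (metis p_def bcb mult.assoc)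

lemma p_b: "p * b = b" "b * p = b"
  by (metis p_def bcb commute) (metis p_def bcb mult.assoc)

lemma p_c: "p * c = c * p"
  by (metis p_def commute mult.assoc)

lemma power_p: "c ^ m * p = c ^ m"
  by (metis p_def absorb commute mult.assoc)

lemma p_power: "p * c ^ m = c ^ m"
  using power_commuting_commutes[OF p_c[symmetric], of m] by (simp add: power_p)

lemma p_eq_power: "p = c ^ n * b ^ n * p"
proof (induction n)
  case (Suc n)
  have "c ^ Suc n * b ^ Suc n * p = c * (c ^ n * b ^ n) * b * p"
    by (metis mult.assoc power_Suc power_Suc2)
  also have "\<dots> = (c ^ n * b ^ n) * (c * b) * p"
    using commuting_power_product[OF commute, of 1 0 n n]
      commuting_power_product[OF commute, of n n 1 0]
    by (simp add: mult.assoc[symmetric])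
  also have "\<dots> = p"
    by (metis Suc.IH p_def p_idem mult.assoc)
  finally show ?case ..
qed simp

text \<open>With \<open>q = 1 - p\<close>, both \<open>q x p\<close> and \<open>p x q\<close> vanish: write \<open>p\<close> as a multiple of
  \<open>c\<^sup>m\<close>, move \<open>c\<^sup>m\<close> past \<open>x\<close>, and let it meet \<open>q\<close>.\<close>

lemma p_commute:
  assumes "x * c = c * x"
  shows "x * p = p * x"
proof -
  have xc: "x * c ^ m = c ^ m * x"
    by (rule power_commuting_commutes[OF assms[symmetric], symmetric])
  have bc: "c ^ m * b ^ m = b ^ m * c ^ m"
    by (rule power_commuting_commutes, rule power_commuting_commutes[symmetric],
        rule commute[symmetric])
  have "p * x * p = p * (x * c ^ m) * b ^ m * p"
    by (metis p_eq_power mult.assoc)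
  also have "\<dots> = x * c ^ m * b ^ m * p"
    by (metis xc p_power mult.assoc)
  also have "\<dots> = x * p"
    by (metis p_eq_power mult.assoc)
  finally have 1: "p * x * p = x * p" .
  have pm: "p = p * (b ^ m * c ^ m)"
  proof -
    have "p * b ^ m = b ^ m * p" "p * c ^ m = c ^ m * p"
      by (rule power_commuting_commutes[symmetric], simp add: p_b p_c)+
    then have "p * (c ^ m * b ^ m) = c ^ m * b ^ m * p"
      by (metis mult.assoc)
    then show ?thesis
      using p_eq_power[of m] bc by metis
  qed
  have "p * x * p = p * b ^ m * (c ^ m * x) * p"
    by (metis pm mult.assoc)
  also have "\<dots> = p * b ^ m * (c ^ m * x)"
    by (metis xc power_p mult.assoc)
  also have "\<dots> = p * x"
    by (metis pm mult.assoc)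
  finally show ?thesis
    using 1 by simp
qed

lemma inverse_commute:
  assumes "x * c = c * x"
  shows "x * b = b * x"
proof -
  have "b * x = b * p * x"
    by (simp add: p_b)
  also have "\<dots> = b * (x * c) * b"
    by (metis assms p_commute p_def mult.assoc)
  also have "\<dots> = p * x * b"
    by (metis assms p_def commute mult.assoc)
  also have "\<dots> = x * b"
    by (metis assms p_commute p_b mult.assoc)
  finally show ?thesis ..
qed

end

section \<open>Invertible elements and the spectrum\<close>

text \<open>Neumann series. Since the norm of \<open>1\<close> is arbitrary, the geometric majorant
  only bounds the terms of positive degree.\<close>

lemma invertible_one_minus:
  fixes x :: "'a::complex_banach_algebra"
  assumes "norm x < 1"
  shows "invertible_elem (1 - x)"
proof -
  have bound: "norm (x ^ Suc n) \<le> norm x ^ Suc n" for n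
  proof (induction n)
    case (Suc n)
    have "norm (x ^ Suc (Suc n)) \<le> norm x * norm (x ^ Suc n)"
      by (simp add: norm_mult_ineq)
    also have "\<dots> \<le> norm x ^ Suc (Suc n)"
      using Suc.IH by (simp add: mult_left_mono)
    finally show ?case .
  qed simp
  have "summable (\<lambda>n. norm x ^ Suc n)"
    using assms by (simp only: summable_Suc_iff) (simp add: summable_geometric)
  then have "summable (\<lambda>n. x ^ Suc n)"
    by (rule summable_comparison_test') (rule bound)
  then have sum: "summable (\<lambda>n. x ^ n)"
    by (simp only: summable_Suc_iff)
  let ?S = "\<Sum>n. x ^ n"
  have shift: "(\<Sum>n. x ^ Suc n) = ?S - 1"
    using suminf_split_head[OF sum] by simp
  have "x * ?S = ?S - 1"
    using suminf_mult[OF sum, of x] shift by simp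
  moreover have "?S * x = ?S - 1"
    using suminf_mult2[OF sum, of x] shift by (simp add: power_commutes)
  ultimately show ?thesis
    unfolding invertible_elem_def
    by (intro exI[of _ ?S]) (simp add: left_diff_distrib right_diff_distrib)
qed

lemma invertible_mult:
  assumes "invertible_elem c" "invertible_elem d"
  shows "invertible_elem (c * d)"
proof -
  obtain c' d' where "c * c' = 1" "c' * c = 1" "d * d' = 1" "d' * d = 1"
    using assms by (auto simp: invertible_elem_def)
  then have "c * d * (d' * c') = 1" "d' * c' * (c * d) = 1"
    by (metis mult.assoc mult_1_right)+
  then show ?thesis
    by (auto simp: invertible_elem_def)
qed

lemma invertible_scaleC:
  assumes "invertible_elem c" "z \<noteq> 0"
  shows "invertible_elem (z *\<^sub>C c)"
proof -
  obtain c' where "c * c' = 1" "c' * c = 1"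
    using assms by (auto simp: invertible_elem_def)
  then show ?thesis
    unfolding invertible_elem_def using assms(2)
    by (intro exI[of _ "inverse z *\<^sub>C c'"])
       (simp add: mult_scaleC_left mult_scaleC_right scaleC_scaleC)
qed

lemma commute_inverse:
  fixes v :: "'a::monoid_mult"
  assumes "v * u = 1" "u * v = 1" "y * v = v * y"
  shows "y * u = u * y"
  by (metis assms mult.assoc mult_1_left mult_1_right)

lemma invertible_minus_small:
  fixes c :: "'a::complex_banach_algebra"
  assumes "c * d = 1" "d * c = 1" "cmod w * norm d < 1"
  shows "invertible_elem (c - w *\<^sub>C 1)"
proof -
  have "invertible_elem (c * (1 - w *\<^sub>C d))"
    using assms
    by (intro invertible_mult invertible_one_minus) (auto simp: norm_scaleC invertible_elem_def)
  then show ?thesis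
    by (simp add: right_diff_distrib mult_scaleC_right assms(1))
qed

lemma bounded_spectrum: "bounded (spectrum a)"
proof -
  have "cmod z \<le> norm a" if "z \<in> spectrum a" for z
  proof (rule ccontr)
    assume z: "\<not> cmod z \<le> norm a"
    then have "z \<noteq> 0"
      using norm_ge_zero[of a] by (intro notI) simp
    then have "invertible_elem ((- z) *\<^sub>C (1 - inverse z *\<^sub>C a))"
      using z by (intro invertible_scaleC invertible_one_minus)
        (auto simp: norm_scaleC norm_inverse norm_divide divide_simps)
    then have "invertible_elem (a - z *\<^sub>C 1)"
      using \<open>z \<noteq> 0\<close> by (simp add: scaleC.diff_right scaleC_scaleC scaleC.minus_left)
    with that show False
      by (simp add: spectrum_def)
  qed
  then show ?thesis
    unfolding bounded_iff by blast
qed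

lemma closed_spectrum: "closed (spectrum a)"
  unfolding closed_def open_dist
proof (intro ballI)
  fix z assume "z \<in> - spectrum a"
  then obtain d where d: "(a - z *\<^sub>C 1) * d = 1" "d * (a - z *\<^sub>C 1) = 1"
    by (auto simp: spectrum_def invertible_elem_def)
  let ?e = "1 / (1 + norm d)"
  have pos: "1 + norm d > 0"
    using norm_ge_zero[of d] by linarith
  have "y \<in> - spectrum a" if "dist y z < ?e" for y
  proof -
    have "cmod (y - z) * (1 + norm d) < 1"
      using that pos by (simp add: dist_norm field_simps)
    then have "cmod (y - z) * norm d < 1"
      using norm_ge_zero[of "y - z"] by (simp only: distrib_left)
    then show ?thesis
      using invertible_minus_small[OF d, of "y - z"]
      by (simp add: diff_diff_scaleC_one spectrum_def)
  qed
  then show "\<exists>e>0. \<forall>y. dist y z < e \<longrightarrow> y \<in> - spectrum a"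
    using pos by (intro exI[of _ ?e]) simp
qed

section \<open>Points of the Drazin resolvent set are isolated in the spectrum\<close>

lemma power_minus_scalar_factor:
  fixes c :: "'a::complex_banach_algebra"
  shows "\<exists>s. (c - w *\<^sub>C 1) * s = c ^ m - w ^ m *\<^sub>C 1 \<and> s * c = c * s"
proof (induction m)
  case 0
  show ?case by (intro exI[of _ 0]) simp
next
  case (Suc m)
  then obtain s where s: "(c - w *\<^sub>C 1) * s = c ^ m - w ^ m *\<^sub>C 1" "s * c = c * s"
    by blast
  have "(c - w *\<^sub>C 1) * (s * c) = (c ^ m - w ^ m *\<^sub>C 1) * c"
    by (simp only: s(1) mult.assoc[symmetric])
  then have "(c - w *\<^sub>C 1) * (s * c + w ^ m *\<^sub>C 1) = c ^ Suc m - w ^ Suc m *\<^sub>C 1"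
    by (simp only: distrib_left)
       (simp add: left_diff_distrib mult_scaleC_left mult_scaleC_right power_commutes
         scaleC.diff_right scaleC_scaleC mult.commute)
  moreover have "(s * c + w ^ m *\<^sub>C 1) * c = c * (s * c + w ^ m *\<^sub>C 1)"
    using s(2) by (simp add: distrib_left distrib_right mult_scaleC_left mult_scaleC_right
      mult.assoc)
  ultimately show ?case by blast
qed

text \<open>For small \<open>w \<noteq> 0\<close>, \<open>c - w\<close> is inverted separately on the two corners: on the one cut
  out by \<open>p\<close> by a Neumann series, since \<open>c\<close> is invertible there, and on the complementary one by
  a finite geometric sum, since \<open>c\<close> is nilpotent there.\<close>

lemma (in drazin_inverse) invertible_punctured:
  assumes "w \<noteq> 0" "cmod w * norm b < 1"
  shows "invertible_elem (c - w *\<^sub>C 1)"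
proof -
  let ?v = "1 - w *\<^sub>C b"
  have "invertible_elem ?v"
    using assms(2) by (intro invertible_one_minus) (simp add: norm_scaleC)
  then obtain u where u: "?v * u = 1" "u * ?v = 1"
    by (auto simp: invertible_elem_def)
  have "c * ?v = ?v * c"
    by (simp add: left_diff_distrib right_diff_distrib mult_scaleC_left mult_scaleC_right commute)
  then have cu: "c * u = u * c"
    by (rule commute_inverse[OF u])
  define x where "x = b * u"
  have xc: "x * c = c * x"
    unfolding x_def by (metis cu commute mult.assoc)
  have "(c - w *\<^sub>C 1) * b = p * ?v"
    by (simp add: left_diff_distrib right_diff_distrib mult_scaleC_left mult_scaleC_right p_b)
       (simp add: p_def)
  then have x1: "(c - w *\<^sub>C 1) * x = p"
    unfolding x_def by (metis u(1) mult.assoc mult_1_right)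
  obtain s where s: "(c - w *\<^sub>C 1) * s = c ^ m - w ^ m *\<^sub>C 1" "s * c = c * s"
    using power_minus_scalar_factor by blast
  define y where "y = (- inverse (w ^ m)) *\<^sub>C (s * (1 - p))"
  have "(c - w *\<^sub>C 1) * (s * (1 - p)) = (c ^ m - w ^ m *\<^sub>C 1) * (1 - p)"
    by (simp only: s(1) mult.assoc[symmetric])
  also have "\<dots> = - (w ^ m *\<^sub>C (1 - p))"
    by (simp add: left_diff_distrib right_diff_distrib mult_scaleC_left scaleC.diff_right power_p)
  finally have y1: "(c - w *\<^sub>C 1) * y = 1 - p"
    using assms(1) unfolding y_def
    by (simp add: mult_scaleC_right scaleC.minus_left scaleC.minus_right scaleC_scaleC)
  have "(s * (1 - p)) * c = c * (s * (1 - p))"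
  proof -
    have "(1 - p) * c = c * (1 - p)"
      by (simp add: left_diff_distrib right_diff_distrib p_c)
    then show ?thesis
      by (metis s(2) mult.assoc)
  qed
  then have yc: "y * c = c * y"
    by (simp add: y_def mult_scaleC_left mult_scaleC_right)
  have "(c - w *\<^sub>C 1) * (x + y) = 1"
    by (simp add: distrib_left x1 y1)
  moreover have "(x + y) * (c - w *\<^sub>C 1) = (c - w *\<^sub>C 1) * (x + y)"
    unfolding diff_scaleC_one_commute by (simp only: distrib_left distrib_right xc yc)
  ultimately show ?thesis
    by (auto simp: invertible_elem_def)
qed

lemma drazin_invertible_obtain:
  assumes "drazin_invertible c"
  obtains b m where "drazin_inverse c b m"
  using assms by (auto simp: drazin_invertible_def drazin_inverse_def)

lemma drazin_resolvent_not_islimpt: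
  assumes "z \<in> drazin_resolvent_set a"
  shows "\<not> z islimpt spectrum a"
proof -
  have "drazin_invertible (a - z *\<^sub>C 1)"
    using assms by (simp add: drazin_resolvent_set_def drazin_spectrum_def)
  then obtain b m where "drazin_inverse (a - z *\<^sub>C 1) b m"
    by (rule drazin_invertible_obtain)
  then interpret drazin_inverse "a - z *\<^sub>C 1" b m .
  have pos: "1 + norm b > 0"
    using norm_ge_zero[of b] by linarith
  have "y \<notin> spectrum a" if "y \<noteq> z" "dist y z < 1 / (1 + norm b)" for y
  proof -
    have "cmod (y - z) * (1 + norm b) < 1"
      using that pos by (simp add: dist_norm field_simps)
    then have "cmod (y - z) * norm b < 1"
      using norm_ge_zero[of "y - z"] by (simp only: distrib_left)
    then show ?thesis
      using invertible_punctured[of "y - z"] that(1)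
      by (simp add: diff_diff_scaleC_one spectrum_def)
  qed
  then show ?thesis
    using pos unfolding islimpt_approachable by (metis zero_less_divide_1_iff)
qed

text \<open>The frontier is compact and has no limit point of the spectrum, so it is finite. Its
  complement is then connected; it contains points outside the bounded spectrum, so it
  cannot meet the spectrum without crossing the frontier.\<close>

lemma finite_spectrum_if_frontier_drazin:
  fixes a :: "'a::complex_banach_algebra"
  assumes "frontier (spectrum a) \<subseteq> drazin_resolvent_set a"
  shows "finite (spectrum a)" "spectrum a \<subseteq> drazin_resolvent_set a"
proof -
  let ?F = "frontier (spectrum a)"
  have sub: "?F \<subseteq> spectrum a"
    by (simp add: closed_spectrum frontier_subset_closed)
  have "compact ?F"
    by (simp add: compact_frontier_bounded bounded_spectrum)
  then have "finite (?F \<inter> spectrum a)"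
    using assms by (intro finite_not_islimpt_in_compact drazin_resolvent_not_islimpt) auto
  then have fin: "finite ?F"
    using sub by (simp add: Int_absorb2)
  have "connected (- ?F)"
    using path_connected_complement_countable[of ?F] fin
    by (simp add: countable_finite path_connected_imp_connected)
  moreover have "- ?F - spectrum a \<noteq> {}"
  proof
    assume "- ?F - spectrum a = {}"
    then have "spectrum a = UNIV"
      using sub by blast
    then show False
      using bounded_spectrum[of a] by simp
  qed
  ultimately have "- ?F \<inter> spectrum a = {}"
    using connected_Int_frontier[of "- ?F" "spectrum a"] by blast
  then have "spectrum a = ?F"
    using sub by blast
  then show "finite (spectrum a)" "spectrum a \<subseteq> drazin_resolvent_set a"
    using fin assms by auto
qed

section \<open>A resolvent on the whole plane is trivial\<close>

text \<open>Boundedness near each point comes from the resolvent identity itself: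
  \<open>\<parallel>R z\<parallel> \<le> \<parallel>R w\<parallel> + \<bar>z - w\<bar> \<parallel>R z\<parallel> \<parallel>R w\<parallel>\<close>, and the last term
  can be absorbed once \<open>\<bar>z - w\<bar> \<parallel>R w\<parallel> \<le> 1/2\<close>.\<close>

lemma resolvent_continuous:
  fixes R :: "complex \<Rightarrow> 'a::complex_banach_algebra"
  assumes res: "\<And>z w. R z - R w = (z - w) *\<^sub>C (R z * R w)"
  shows "isCont R w"
proof -
  let ?M = "norm (R w)"
  have bound: "norm (R z - R w) \<le> cmod (z - w) * (2 * ?M * ?M)"
    if z: "cmod (z - w) * ?M \<le> 1 / 2" for z
  proof -
    have est: "norm (R z - R w) \<le> cmod (z - w) * (norm (R z) * ?M)"
      by (subst res) (simp add: norm_scaleC norm_mult_ineq mult_left_mono)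
    have "norm (R z) \<le> norm (R z - R w) + ?M"
      by (metis diff_add_cancel norm_triangle_ineq)
    also have "\<dots> \<le> norm (R z) * (cmod (z - w) * ?M) + ?M"
      using est by (simp add: mult_ac)
    also have "\<dots> \<le> norm (R z) * (1 / 2) + ?M"
      using z by (intro add_right_mono mult_left_mono) auto
    finally have "norm (R z) \<le> 2 * ?M"
      by simp
    then show ?thesis
      using est by (meson mult_left_mono mult_right_mono norm_ge_zero order_trans)
  qed
  have "((\<lambda>z. cmod (z - w) * ?M) \<longlongrightarrow> cmod (w - w) * ?M) (at w)"
    by (intro tendsto_intros)
  then have "\<forall>\<^sub>F z in at w. cmod (z - w) * ?M < 1 / 2"
    by (rule order_tendstoD) simp
  then have ev: "\<forall>\<^sub>F z in at w. norm (R z - R w) \<le> cmod (z - w) * (2 * ?M * ?M)"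
    by eventually_elim (use bound in simp)
  have "((\<lambda>z. cmod (z - w) * (2 * ?M * ?M)) \<longlongrightarrow> cmod (w - w) * (2 * ?M * ?M)) (at w)"
    by (intro tendsto_intros)
  then have "((\<lambda>z. cmod (z - w) * (2 * ?M * ?M)) \<longlongrightarrow> 0) (at w)"
    by simp
  then have "((\<lambda>z. R z - R w) \<longlongrightarrow> 0) (at w)"
    by (rule Lim_null_comparison[OF ev])
  then show ?thesis
    by (simp add: isCont_def LIM_zero_iff)
qed

lemma resolvent_has_derivative:
  fixes R :: "complex \<Rightarrow> 'a::complex_banach_algebra"
  assumes res: "\<And>z w. R z - R w = (z - w) *\<^sub>C (R z * R w)"
  shows "(R has_derivative (\<lambda>v. v *\<^sub>C (R w * R w))) (at w)"
  unfolding has_derivative_at_within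
proof (intro conjI)
  show "bounded_linear (\<lambda>v. v *\<^sub>C (R w * R w))"
    by (rule scaleC.bounded_linear_left)
  have diff: "R z - R w - (z - w) *\<^sub>C (R w * R w) = (z - w) *\<^sub>C ((R z - R w) * R w)" for z
    by (simp only: left_diff_distrib scaleC.diff_right res[of z w, symmetric])
  have "((\<lambda>z. (R z - R w) * R w) \<longlongrightarrow> (R w - R w) * R w) (at w)"
    using resolvent_continuous[OF res, of w] by (intro tendsto_intros) (simp add: isCont_def)
  then have lim: "((\<lambda>z. norm ((R z - R w) * R w)) \<longlongrightarrow> 0) (at w)"
    by (simp add: tendsto_norm_zero)
  show "((\<lambda>z. (R z - R w - (z - w) *\<^sub>C (R w * R w)) /\<^sub>R norm (z - w)) \<longlongrightarrow> 0) (at w)"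
  proof (rule Lim_null_comparison[OF _ lim], rule eventuallyI)
    fix z
    show "norm ((R z - R w - (z - w) *\<^sub>C (R w * R w)) /\<^sub>R norm (z - w))
        \<le> norm ((R z - R w) * R w)"
      unfolding diff by (cases "z = w") (simp_all add: norm_scaleC mult.assoc[symmetric])
  qed
qed

text \<open>If \<open>h\<close> has a continuous complex derivative, its mean over the circle of radius \<open>r\<close> about
  the origin does not depend on \<open>r\<close>: differentiating under the integral gives the mean of
  \<open>e\<^sup>i\<^sup>t h' (r e\<^sup>i\<^sup>t)\<close>, which is the \<open>t\<close>-derivative of a \<open>2\<pi>\<close>-periodic function.
  That function is \<open>h (r e\<^sup>i\<^sup>t) / (\<i> r)\<close> for \<open>r \<noteq> 0\<close> and \<open>- \<i> e\<^sup>i\<^sup>t h' 0\<close> for \<open>r = 0\<close>.\<close>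

lemma circle_integral_constant:
  fixes h :: "complex \<Rightarrow> 'a::complex_banach_algebra"
  assumes deriv: "\<And>z. (h has_derivative (\<lambda>v. v *\<^sub>C h' z)) (at z)"
    and cont: "continuous_on UNIV h'"
    and "0 \<le> r"
  shows "integral {0..2*pi} (\<lambda>t. h (complex_of_real r * cis t)) = (2 * pi) *\<^sub>R h 0"
proof -
  let ?J = "\<lambda>r. integral {0..2*pi} (\<lambda>t. h (complex_of_real r * cis t))"
  let ?D = "\<lambda>r t. cis t *\<^sub>C h' (complex_of_real r * cis t)"
  have conth: "continuous_on UNIV h"
    using deriv by (meson continuous_at_imp_continuous_on has_derivative_continuous)
  have cis_deriv: "(cis has_vector_derivative (\<i> * cis t)) (at t within S)" for t S
    unfolding has_vector_derivative_def
    by (rule has_derivative_eq_rhs, rule has_derivative_cis) (auto intro!: derivative_eq_intros)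
  have radial: "((\<lambda>r. h (complex_of_real r * cis t)) has_vector_derivative ?D r t)
      (at r within {0..})" for r t
  proof -
    have "((\<lambda>r. complex_of_real r * cis t) has_derivative (\<lambda>s. complex_of_real s * cis t))
        (at r within {0..})"
      by (auto intro!: derivative_eq_intros)
    then show ?thesis
      unfolding has_vector_derivative_def
      by (rule has_derivative_eq_rhs[OF has_derivative_compose[OF _ deriv]])
         (simp add: scaleC_scaleC scaleR_scaleC)
  qed
  have angular: "((\<lambda>t. h (complex_of_real r * cis t))
      has_vector_derivative ((complex_of_real r * \<i>) *\<^sub>C ?D r t)) (at t within {0..2*pi})" for r t
  proof -
    have "((\<lambda>t. complex_of_real r * cis t) has_derivative
        (\<lambda>s. complex_of_real s * (complex_of_real r * \<i> * cis t))) (at t within {0..2*pi})"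
      by (rule has_derivative_eq_rhs[OF has_derivative_mult_right[OF
            cis_deriv[unfolded has_vector_derivative_def]]])
         (simp add: scaleR_conv_of_real mult_ac)
    then show ?thesis
      unfolding has_vector_derivative_def
      by (rule has_derivative_eq_rhs[OF has_derivative_compose[OF _ deriv]])
         (simp add: scaleC_scaleC scaleR_scaleC mult_ac)
  qed
  have zero: "integral {0..2*pi} (?D r) = 0" for r
  proof (cases "r = 0")
    case True
    let ?G = "\<lambda>t. (- \<i> * cis t) *\<^sub>C h' 0"
    have "(?G has_vector_derivative ?D r t) (at t within {0..2*pi})" for t
    proof -
      have "((\<lambda>t. - \<i> * cis t) has_vector_derivative (- \<i> * (\<i> * cis t))) (at t within {0..2*pi})"
        by (intro has_vector_derivative_mult_right cis_deriv)
      then have "(?G has_vector_derivative (- \<i> * (\<i> * cis t)) *\<^sub>C h' 0) (at t within {0..2*pi})"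
        by (rule bounded_linear.has_vector_derivative[OF scaleC.bounded_linear_left])
      then show ?thesis
        using True by (simp add: mult.assoc[symmetric])
    qed
    then have "(?D r has_integral ?G (2 * pi) - ?G 0) {0..2*pi}"
      by (intro fundamental_theorem_of_calculus) auto
    then show ?thesis
      by (simp add: integral_unique)
  next
    case False
    let ?G = "\<lambda>t. inverse (complex_of_real r * \<i>) *\<^sub>C h (complex_of_real r * cis t)"
    have "(?G has_vector_derivative ?D r t) (at t within {0..2*pi})" for t
      using bounded_linear.has_vector_derivative[OF scaleC.bounded_linear_right angular,
          of "inverse (complex_of_real r * \<i>)" r t] False
      by (simp add: scaleC_scaleC field_simps)
    then have "(?D r has_integral ?G (2 * pi) - ?G 0) {0..2*pi}"
      by (intro fundamental_theorem_of_calculus) auto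
    then show ?thesis
      by (simp add: integral_unique)
  qed
  have integrable: "(\<lambda>t. h (complex_of_real r * cis t)) integrable_on {0..2*pi}" for r
    by (intro integrable_continuous_real continuous_on_compose2[OF conth] continuous_intros) auto
  have contD: "continuous_on ({0..} \<times> cbox 0 (2 * pi)) (\<lambda>(r, t). ?D r t)"
    unfolding split_beta
    by (intro scaleC.continuous_on continuous_on_compose2[OF cont] continuous_intros) auto
  have "(?J has_vector_derivative 0) (at r within {0..})" if "r \<in> {0..}" for r
  proof -
    have "((\<lambda>r. integral (cbox 0 (2 * pi)) (\<lambda>t. h (complex_of_real r * cis t)))
        has_vector_derivative integral (cbox 0 (2 * pi)) (?D r)) (at r within {0..})"
      by (rule leibniz_rule_vector_derivative[OF radial _ contD that])
         (simp_all add: integrable convex_real_interval)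
    then show ?thesis
      by (simp add: zero)
  qed
  then have "\<exists>c. \<forall>r\<in>{0..}. ?J r = c"
    using has_vector_derivative_zero_constant[of "{0..}" ?J] convex_real_interval(1) by blast
  then have "?J r = ?J 0"
    using \<open>0 \<le> r\<close> by (metis atLeast_iff order_refl)
  then show ?thesis
    by simp
qed

text \<open>This is Liouville's theorem for the entire function \<open>R\<close>, with \<open>f\<close> in the role of the unit
  of the corner where \<open>R\<close> inverts \<open>a - z\<close>. The function \<open>h z = z R z\<close> vanishes at \<open>0\<close>, hence so
  does its mean over every circle about \<open>0\<close>; but \<open>h z + f = a R z\<close> tends to \<open>0\<close> at infinity, so
  this mean tends to \<open>- f\<close>.\<close>

lemma entire_resolvent_trivial:
  fixes R :: "complex \<Rightarrow> 'a::complex_banach_algebra"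
  assumes res: "\<And>z w. R z - R w = (z - w) *\<^sub>C (R z * R w)"
    and inv: "\<And>z. (a - z *\<^sub>C 1) * R z = f"
  shows "f = 0"
proof -
  define h where "h z = z *\<^sub>C R z" for z
  define h' where "h' z = z *\<^sub>C (R z * R z) + R z" for z
  have deriv: "(h has_derivative (\<lambda>v. v *\<^sub>C h' z)) (at z)" for z
    unfolding h_def h'_def
    by (rule has_derivative_eq_rhs,
        rule scaleC.FDERIV[OF has_derivative_ident resolvent_has_derivative[OF res]])
       (simp add: scaleC_add_right scaleC_scaleC mult.commute)
  have contR: "continuous_on UNIV R"
    by (intro continuous_at_imp_continuous_on ballI resolvent_continuous res)
  have cont: "continuous_on UNIV h'"
    unfolding h'_def by (intro continuous_intros contR scaleC.continuous_on)
  have conth: "continuous_on UNIV h"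
    unfolding h_def by (intro continuous_intros contR scaleC.continuous_on)
  have aR: "h z + f = a * R z" for z
    using inv[of z] by (simp add: h_def left_diff_distrib mult_scaleC_left diff_eq_eq add.commute)
  have "norm f \<le> norm a * (norm f / (r - norm a))" if r: "r > norm a" for r
  proof -
    have r0: "0 < r"
      using r norm_ge_zero[of a] by linarith
    have decay: "norm (h z + f) \<le> norm a * (norm f / (r - norm a))" if z: "cmod z = r" for z
    proof -
      have "r * norm (R z) = norm (a * R z - f)"
        unfolding aR[of z, symmetric] by (simp add: h_def norm_scaleC z)
      also have "\<dots> \<le> norm a * norm (R z) + norm f"
        by (meson add_right_mono norm_mult_ineq norm_triangle_ineq4 order_trans)
      finally have "norm (R z) * (r - norm a) \<le> norm f"
        by (simp add: algebra_simps)
      then have "norm (R z) \<le> norm f / (r - norm a)"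
        using r by (simp add: pos_le_divide_eq)
      then show ?thesis
        unfolding aR by (meson mult_left_mono norm_ge_zero norm_mult_ineq order_trans)
    qed
    let ?g = "\<lambda>t. h (complex_of_real r * cis t)"
    have int: "?g integrable_on cbox 0 (2 * pi)"
      by (intro integrable_continuous continuous_on_compose2[OF conth] continuous_intros) auto
    have "integral (cbox 0 (2 * pi)) ?g = 0"
      using circle_integral_constant[OF deriv cont, of r] r0 by (simp add: h_def scaleC.zero_left)
    then have "((\<lambda>t. ?g t + f) has_integral (2 * pi) *\<^sub>R f) (cbox 0 (2 * pi))"
      using has_integral_add[OF integrable_integral[OF int] has_integral_const[of f 0 "2 * pi"]]
      by simp
    then have "norm ((2 * pi) *\<^sub>R f)
        \<le> norm a * (norm f / (r - norm a)) * measure lborel (cbox 0 (2 * pi))"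
      using r r0 by (intro has_integral_bound[where f = "\<lambda>t. ?g t + f"])
        (auto intro!: decay[simplified] simp: norm_mult)
    then have "(2 * pi) * norm f \<le> (2 * pi) * (norm a * (norm f / (r - norm a)))"
      by (simp add: norm_mult mult_ac)
    then show ?thesis
      by (rule mult_left_le_imp_le) simp
  qed
  \<comment> \<open>Any radius for which the factor of \<open>norm f\<close> on the right is below \<open>1\<close> will do; here it
    is \<open>norm a / (2 * norm a + 1)\<close>.\<close>
  from this[of "norm a + (2 * norm a + 1)"]
  have "norm f \<le> norm a * norm f / (2 * norm a + 1)"
    using norm_ge_zero[of a] by simp
  moreover have "2 * norm a + 1 > 0"
    using norm_ge_zero[of a] by linarith
  ultimately have "norm f * (2 * norm a + 1) \<le> norm a * norm f"
    by (simp only: pos_le_divide_eq)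
  then have "norm f * (norm a + 1) \<le> 0"
    by (simp add: algebra_simps)
  moreover have "norm a + 1 > 0"
    using norm_ge_zero[of a] by linarith
  ultimately show ?thesis
    by (simp add: mult_le_0_iff)
qed

section \<open>Splitting off finitely many points of the spectrum\<close>

definition double_commutant :: "'a::complex_banach_algebra \<Rightarrow> 'a set" where
  "double_commutant a = {x. \<forall>y. y * a = a * y \<longrightarrow> x * y = y * x}"

lemma double_commutant_commute:
  assumes "x \<in> double_commutant a" "y \<in> double_commutant a"
  shows "x * y = y * x"
proof -
  have "y * a = a * y"
    using assms(2) by (simp add: double_commutant_def)
  then show ?thesis
    using assms(1) by (simp add: double_commutant_def)
qed

lemma one_in_double_commutant: "1 \<in> double_commutant a"
  by (simp add: double_commutant_def)

lemma mult_in_double_commutant: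
  assumes "x \<in> double_commutant a" "y \<in> double_commutant a"
  shows "x * y \<in> double_commutant a"
  unfolding double_commutant_def
proof (intro CollectI allI impI)
  fix v assume "v * a = a * v"
  then have "x * v = v * x" "y * v = v * y"
    using assms by (simp_all add: double_commutant_def)
  then show "x * y * v = v * (x * y)"
    by (metis mult.assoc)
qed

lemma diff_in_double_commutant: "a - z *\<^sub>C 1 \<in> double_commutant a"
  by (auto simp: double_commutant_def diff_scaleC_one_commute[symmetric])
     (metis diff_scaleC_one_commute)

lemma (in drazin_inverse) inverse_in_double_commutant:
  assumes "c = a - z *\<^sub>C 1"
  shows "b \<in> double_commutant a"
  unfolding double_commutant_def using inverse_commute
  by (simp add: assms diff_scaleC_one_commute)

text \<open>A relative resolvent at \<open>z\<close>: an inverse of \<open>a - z\<close> in the corner cut out by the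
  idempotent \<open>f\<close>.\<close>

definition relative_resolvent :: "'a::complex_banach_algebra \<Rightarrow> 'a \<Rightarrow> complex \<Rightarrow> 'a \<Rightarrow> bool" where
  "relative_resolvent a f z r \<longleftrightarrow>
     r \<in> double_commutant a \<and> (a - z *\<^sub>C 1) * r = f \<and> r * f = r"

lemma relative_resolvent_mult:
  assumes r: "relative_resolvent a f z r"
    and f: "f \<in> double_commutant a" and e: "e \<in> double_commutant a" "e * e = e"
  shows "relative_resolvent a (f * e) z (r * e)"
proof -
  have rd: "r \<in> double_commutant a"
    using r by (simp add: relative_resolvent_def)
  have "r * e * (f * e) = r * f * (e * e)"
    using double_commutant_commute[OF e(1) f] by (metis mult.assoc)
  then show ?thesis
    using r e rd by (simp add: relative_resolvent_def mult_in_double_commutant mult.assoc[symmetric])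
qed

text \<open>The idempotent \<open>f\<close> is the product of the complements of the spectral projections at the
  points of \<open>S\<close>, so that a suitable \<open>P (a)\<close> annihilates \<open>1 - f\<close>. Working in the double
  commutant makes all the Drazin inverses commute.\<close>

lemma split_off_finite:
  fixes a :: "'a::complex_banach_algebra"
  assumes "finite S" "S \<subseteq> drazin_resolvent_set a"
  shows "\<exists>f P. f \<in> double_commutant a \<and> f * f = f \<and> P \<noteq> 0 \<and> poly_eval P a * f = poly_eval P a
    \<and> (\<forall>z\<in>S. \<exists>r. relative_resolvent a f z r)"
  using assms
proof (induction S)
  case empty
  show ?case
    by (intro exI[of _ 1]) (simp add: one_in_double_commutant)
next
  case (insert z S)
  then obtain f P where f: "f \<in> double_commutant a" "f * f = f"
    and P: "P \<noteq> 0" "poly_eval P a * f = poly_eval P a"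
    and res: "\<And>w. w \<in> S \<Longrightarrow> \<exists>r. relative_resolvent a f w r"
    by auto
  have "drazin_invertible (a - z *\<^sub>C 1)"
    using insert.prems by (simp add: drazin_resolvent_set_def drazin_spectrum_def)
  then obtain b m where "drazin_inverse (a - z *\<^sub>C 1) b m"
    by (rule drazin_invertible_obtain)
  then interpret drazin_inverse "a - z *\<^sub>C 1" b m .
  have b: "b \<in> double_commutant a"
    by (rule inverse_in_double_commutant) simp
  then have p: "p \<in> double_commutant a"
    unfolding p_def by (intro mult_in_double_commutant diff_in_double_commutant)
  have fp: "f * p = p * f" and fb: "f * b = b * f"
    using double_commutant_commute f p b by blast+
  have idem: "f * p * (f * p) = f * p"
  proof -
    have "f * p * (f * p) = f * (p * f) * p"
      by (simp only: mult.assoc)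
    also have "\<dots> = f * f * (p * p)"
      by (simp only: fp[symmetric] mult.assoc)
    finally show ?thesis
      by (simp only: f(2) p_idem)
  qed
  let ?P = "P * [:- z, 1:] ^ m"
  have eval: "poly_eval ?P a = poly_eval P a * (a - z *\<^sub>C 1) ^ m"
    by (simp only: poly_eval_mult poly_eval_power poly_eval_linear)
  have "(a - z *\<^sub>C 1) ^ m * f = f * (a - z *\<^sub>C 1) ^ m"
    by (intro power_commuting_commutes double_commutant_commute[OF diff_in_double_commutant f(1)])
  then have "poly_eval ?P a * (f * p) = poly_eval P a * f * ((a - z *\<^sub>C 1) ^ m * p)"
    by (simp only: eval) (metis mult.assoc)
  also have "\<dots> = poly_eval ?P a"
    by (simp only: eval P(2) power_p)
  finally have absorb: "poly_eval ?P a * (f * p) = poly_eval ?P a" .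
  have "relative_resolvent a p z b"
    using b p_b by (simp add: relative_resolvent_def p_def)
  then have "relative_resolvent a (p * f) z (b * f)"
    by (rule relative_resolvent_mult[OF _ p f])
  then have "\<exists>r. relative_resolvent a (f * p) w r" if "w \<in> insert z S" for w
    using that res[of w] relative_resolvent_mult[OF _ f(1) p p_idem] by (auto simp: fp)
  moreover have "?P \<noteq> 0"
    using P(1) by simp
  ultimately show ?case
    using mult_in_double_commutant[OF f(1) p] idem absorb by blast
qed

lemma relative_resolvent_outside_spectrum:
  assumes f: "f \<in> double_commutant a" "f * f = f" and "z \<notin> spectrum a"
  shows "\<exists>r. relative_resolvent a f z r"
proof -
  obtain d where d: "(a - z *\<^sub>C 1) * d = 1" "d * (a - z *\<^sub>C 1) = 1"
    using assms(3) by (auto simp: spectrum_def invertible_elem_def)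
  have "d * y = y * d" if "y * a = a * y" for y
    using that by (intro commute_inverse[OF d, symmetric]) (simp add: diff_scaleC_one_commute)
  then have "d \<in> double_commutant a"
    by (simp add: double_commutant_def)
  then have "relative_resolvent a f z (d * f)"
    using f d by (simp add: relative_resolvent_def mult_in_double_commutant mult.assoc)
       (simp add: mult.assoc[symmetric])
  then show ?thesis ..
qed

lemma algebraic_if_frontier_drazin:
  fixes a :: "'a::complex_banach_algebra"
  assumes "frontier (spectrum a) \<subseteq> drazin_resolvent_set a"
  shows "algebraic_elem a"
proof -
  obtain f P where f: "f \<in> double_commutant a" "f * f = f"
    and P: "P \<noteq> 0" "poly_eval P a * f = poly_eval P a"
    and "\<forall>z\<in>spectrum a. \<exists>r. relative_resolvent a f z r"
    using split_off_finite finite_spectrum_if_frontier_drazin[OF assms] by metis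
  then have "\<forall>z. \<exists>r. relative_resolvent a f z r"
    using relative_resolvent_outside_spectrum[OF f] by blast
  then obtain R where R: "\<And>z. relative_resolvent a f z (R z)"
    by metis
  have "R z - R w = (z - w) *\<^sub>C (R z * R w)" for z w
  proof -
    have dc: "R u \<in> double_commutant a" and inv: "(a - u *\<^sub>C 1) * R u = f"
      and "R u * f = R u" for u
      using R[of u] by (simp_all add: relative_resolvent_def)
    then have fR: "f * R u = R u" for u
      using double_commutant_commute[OF f(1)] by simp
    have comm: "R z * R w = R w * R z"
      by (rule double_commutant_commute[OF dc dc])
    have "(a - w *\<^sub>C 1) * (R z * R w) = R z"
      by (simp only: comm mult.assoc[symmetric] inv fR)
    moreover have "(a - z *\<^sub>C 1) * (R z * R w) = R w"
      by (simp only: mult.assoc[symmetric] inv fR)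
    ultimately have "R z - R w = (a - w *\<^sub>C 1 - (a - z *\<^sub>C 1)) * (R z * R w)"
      by (simp only: left_diff_distrib)
    then show ?thesis
      by (simp add: left_diff_distrib mult_scaleC_left scaleC.diff_left)
  qed
  then have "f = 0"
    using R by (intro entire_resolvent_trivial[of R a]) (auto simp: relative_resolvent_def)
  then show ?thesis
    using P by (auto simp: algebraic_elem_def)
qed

section \<open>Algebraic elements\<close>

text \<open>Write \<open>P = (X - z)\<^sup>m Q\<close> with \<open>Q (z) \<noteq> 0\<close> and \<open>Q = Q (z) + (X - z) S\<close>. Then
  \<open>P (a) = 0\<close> expresses \<open>(a - z)\<^sup>m\<close> as \<open>(a - z)\<^sup>m\<^sup>+\<^sup>1\<close> times a polynomial in \<open>a\<close>.\<close>

lemma algebraic_imp_drazin_invertible: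
  fixes a :: "'a::complex_banach_algebra"
  assumes "algebraic_elem a"
  shows "drazin_invertible (a - z *\<^sub>C 1)"
proof -
  obtain P where P: "P \<noteq> 0" "poly_eval P a = 0"
    using assms by (auto simp: algebraic_elem_def)
  define m where "m = order z P"
  obtain Q where Q: "P = [:- z, 1:] ^ m * Q" "\<not> [:- z, 1:] dvd Q"
    using order_decomp[OF P(1)] m_def by blast
  define k where "k = poly Q z"
  have k: "k \<noteq> 0"
    using Q(2) by (simp add: k_def poly_eq_0_iff_dvd)
  have "[:- z, 1:] dvd Q - [:k:]"
    by (simp add: k_def poly_eq_0_iff_dvd[symmetric])
  then obtain S where "Q - [:k:] = [:- z, 1:] * S" ..
  then have S: "Q = [:k:] + [:- z, 1:] * S"
    by (simp add: diff_eq_eq add.commute)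
  let ?c = "a - z *\<^sub>C 1" and ?s = "poly_eval S a"
  have "?c ^ m * (k *\<^sub>C 1 + ?c * ?s) = 0"
  proof -
    have "poly_eval [:k:] a = k *\<^sub>C 1"
      by (simp add: poly_eval_pCons)
    then show ?thesis
      using P(2) unfolding Q(1) S
      by (simp only: poly_eval_mult poly_eval_power poly_eval_linear poly_eval_add)
  qed
  then have "k *\<^sub>C ?c ^ m = - (?c ^ Suc m * ?s)"
    by (simp add: distrib_left mult_scaleC_right power_Suc2 mult.assoc add_eq_0_iff del: power_Suc)
  then have "inverse k *\<^sub>C (k *\<^sub>C ?c ^ m) = inverse k *\<^sub>C (- (?c ^ Suc m * ?s))"
    by (rule arg_cong)
  then have "?c ^ m = ?c ^ Suc m * ((- inverse k) *\<^sub>C ?s)"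
    using k by (simp add: scaleC_scaleC mult_scaleC_right scaleC.minus_left scaleC.minus_right)
  moreover have "?c * ((- inverse k) *\<^sub>C ?s) = ((- inverse k) *\<^sub>C ?s) * ?c"
  proof -
    have "?s * ?c = ?c * ?s"
      unfolding diff_scaleC_one_commute by (rule poly_eval_commute)
    then show ?thesis
      by (simp only: mult_scaleC_left mult_scaleC_right)
  qed
  ultimately show ?thesis
    by (rule drazin_invertible_if_power_stable[rotated])
qed

theorem theorem2p1:
  fixes a :: "'a::complex_banach_algebra"
  shows "(drazin_spectrum a = {} \<longleftrightarrow> frontier (spectrum a) \<subseteq> drazin_resolvent_set a) \<and>
         (frontier (spectrum a) \<subseteq> drazin_resolvent_set a \<longleftrightarrow> algebraic_elem a)"
proof -
  have "frontier (spectrum a) \<subseteq> drazin_resolvent_set a" if "drazin_spectrum a = {}"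
    using that by (simp add: drazin_resolvent_set_def)
  moreover have "drazin_spectrum a = {}" if "algebraic_elem a"
    using algebraic_imp_drazin_invertible[OF that] by (simp add: drazin_spectrum_def)
  ultimately show ?thesis
    using algebraic_if_frontier_drazin by blast
qed

end
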